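(* Let $m_1, m_2$ be positive integers with $\frac{\sqrt 5 +1}{2}\, m_2<m_1<3m_2$. Then $$ R (S (m_1, m_2)) \leq \Big\lceil\sqrt{2m_1^2+\big(m_1+\tfrac{m_2}{2}\big)^2} +\frac{m_2}{2}\Big\rceil+1. $$
   Context: All graphs are finite and simple. For non-negative integers $m_1,m_2$, the double star $S(m_1,m_2)$ is the tree obtained from a star with $m_1$ leaves and a vertex-disjoint star with $m_2$ leaves by adding an edge joining their centres (so it has $m_1+m_2+2$ vertices). For a graph $H$, the (two-colour) Ramsey number $R(H)$ is the smallest integer $n$ such that every colouring of the edges of the complete graph $K_n$ with two colours contains a monochromatic copy of $H$ (as a not necessarily induced subgraph). *)

theory Defs
  imports "HOL-Analysis.Analysis" "HOL-Library.Ramsey"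
begin

text \<open>A finite simple graph is a pair of a finite vertex set and a set of 2-element subsets of it.\<close>

type_synonym 'a graph = "'a set \<times> 'a set set"

definition simple_graph :: "'a graph \<Rightarrow> bool" where
  "simple_graph G \<longleftrightarrow> finite (fst G) \<and> snd G \<subseteq> nsets (fst G) 2"

definition contains_copy :: "'b graph \<Rightarrow> 'a graph \<Rightarrow> bool" where
  "contains_copy G H \<longleftrightarrow>
     (\<exists>f. inj_on f (fst H) \<and> f ` fst H \<subseteq> fst G \<and> (\<forall>e \<in> snd H. f ` e \<in> snd G))"

text \<open>Edge colourings of the complete graph on \<open>{..<n}\<close> are total functions into \<^typ>\<open>bool\<close>;
  only their values on the edges matter.\<close>

definition colour_class :: "nat \<Rightarrow> (nat set \<Rightarrow> bool) \<Rightarrow> bool \<Rightarrow> nat graph" where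
  "colour_class n c b = ({..<n}, {e \<in> nsets {..<n} 2. c e = b})"

definition arrows :: "nat \<Rightarrow> 'a graph \<Rightarrow> bool" where
  "arrows n H \<longleftrightarrow> (\<forall>c. \<exists>b. contains_copy (colour_class n c b) H)"

definition ramsey_number :: "'a graph \<Rightarrow> nat" where
  "ramsey_number H = (LEAST n. arrows n H)"

text \<open>By Ramsey's theorem, the minimum in the definition of \<^const>\<open>ramsey_number\<close> exists.\<close>

lemma arrows_exists:
  assumes "simple_graph H"
  shows "\<exists>n. arrows n H"
proof -
  let ?k = "card (fst H)"
  have fin: "finite (fst H)" and sub: "snd H \<subseteq> nsets (fst H) 2"
    using assms by (auto simp: simple_graph_def)
  obtain N :: nat where N: "partn_lst {..<N} [?k, ?k] 2"
    using ramsey_full by blast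
  have "\<exists>b. contains_copy (colour_class N c b) H" for c
  proof -
    define g where "g e = (if c e then 1 else 0 :: nat)" for e
    have "g \<in> nsets {..<N} 2 \<rightarrow> {..<length [?k, ?k]}"
      by (auto simp: g_def)
    then obtain i where i: "i < length [?k, ?k]" "monochromatic {..<N} ([?k, ?k] ! i) 2 g i"
      using N unfolding partn_lst_def by blast
    then have "[?k, ?k] ! i = ?k"
      by (auto simp: less_Suc_eq)
    then obtain K where K: "K \<in> nsets {..<N} ?k" "g ` nsets K 2 \<subseteq> {i}"
      using i by (auto simp: monochromatic_def)
    then have "finite K" "card K = ?k" "K \<subseteq> {..<N}"
      by (auto simp: nsets_def)
    then obtain f where f: "bij_betw f (fst H) K"
      using fin finite_same_card_bij by metis
    have "f ` e \<in> nsets K 2" if "e \<in> snd H" for e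
    proof -
      have "e \<in> nsets (fst H) 2" using sub that by blast
      then show ?thesis
        using f bij_betw_nsets[OF f, of 2] by (auto simp: bij_betw_def)
    qed
    moreover have "e \<in> nsets {..<N} 2 \<and> c e = (i = 1)" if "e \<in> nsets K 2" for e
    proof -
      have "g e = i" using K that by blast
      then show ?thesis
        using nsets_mono[OF \<open>K \<subseteq> {..<N}\<close>] that by (auto simp: g_def split: if_splits)
    qed
    ultimately have "contains_copy (colour_class N c (i = 1)) H"
      unfolding contains_copy_def colour_class_def
      using f \<open>K \<subseteq> {..<N}\<close> by (intro exI[of _ f]) (auto simp: bij_betw_def)
    then show ?thesis by blast
  qed
  then show ?thesis by (auto simp: arrows_def)
qed

lemma arrows_ramsey_number:
  assumes "simple_graph H"
  shows "arrows (ramsey_number H) H"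
  using arrows_exists[OF assms] unfolding ramsey_number_def by (rule LeastI_ex)

text \<open>The star with \<open>m\<close> leaves has centre \<open>0\<close> and leaves \<open>1, \<dots>, m\<close>; the double star joins
  the centres of two stars tagged apart by \<^const>\<open>Inl\<close> and \<^const>\<open>Inr\<close>.\<close>

definition star :: "nat \<Rightarrow> nat graph" where
  "star m = ({0..m}, {{0, i} | i. i \<in> {1..m}})"

definition double_star :: "nat \<Rightarrow> nat \<Rightarrow> (nat + nat) graph" where
  "double_star m1 m2 =
     (Inl ` fst (star m1) \<union> Inr ` fst (star m2),
      image Inl ` snd (star m1) \<union> image Inr ` snd (star m2) \<union> {{Inl 0, Inr 0}})"

lemma simple_graph_double_star: "simple_graph (double_star m1 m2)"
  by (auto simp: simple_graph_def double_star_def star_def)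

lemma card_double_star: "card (fst (double_star m1 m2)) = m1 + m2 + 2"
proof -
  have "fst (double_star m1 m2) = {0..m1} <+> {0..m2}"
    by (auto simp: double_star_def star_def)
  then show ?thesis by (simp add: card_Plus)
qed

end

theory Submission
  imports Defs
begin

text \<open>Suppose that a colouring of \<open>K\<^sub>n\<close> has no monochromatic double star. If \<open>uv\<close> is an edge of
  colour \<open>b\<close> whose ends have \<open>b\<close>-degrees above \<open>m\<^sub>1\<close> and \<open>m\<^sub>2\<close>, then their \<open>b\<close>-neighbourhoods
  cover at most \<open>m\<^sub>1 + m\<^sub>2 + 1\<close> vertices, so \<open>u\<close> and \<open>v\<close> have at least \<open>n - m\<^sub>1 - m\<^sub>2 - 1\<close> common
  neighbours in the other colour. Since \<open>n > m\<^sub>1 + 2m\<^sub>2 + 1\<close>, no vertex has degree at most \<open>m\<^sub>2\<close> in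
  either colour. Counting triangles across a partition into vertices of red degree and of blue
  degree above \<open>m\<^sub>1\<close> shows that one of the parts is empty, so all vertices have degree at most
  \<open>m\<^sub>1\<close> in the same colour, say blue. Fix a vertex \<open>u\<close> and double count the blue edges between
  its red and its blue neighbours. A red neighbour lies on at least \<open>n - m\<^sub>1 - m\<^sub>2 - 1\<close> of them; a
  blue neighbour \<open>w\<close> on fewer than \<open>2(2m\<^sub>1 + m\<^sub>2 + 1 - n)\<close>, because the red neighbourhood of
  a common red neighbour of \<open>u\<close> and \<open>w\<close> differs little from those of \<open>u\<close> and of \<open>w\<close>. The
  resulting quadratic inequality in \<open>n\<close> contradicts the bound.\<close>

section \<open>Neighbourhoods in one colour and the embedding of a double star\<close>

text \<open>\<open>c\<close> is total, so its meaningless value at the singleton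
  \<open>{v, v}\<close> has to be excluded.\<close>

definition nbrs :: "'a set \<Rightarrow> ('a set \<Rightarrow> bool) \<Rightarrow> bool \<Rightarrow> 'a \<Rightarrow> 'a set" where
  "nbrs V c b v = {w \<in> V. w \<noteq> v \<and> c {v, w} = b}"

lemma finite_nbrs [simp]: "finite V \<Longrightarrow> finite (nbrs V c b v)"
  by (simp add: nbrs_def)

lemma nbrs_sym: "u \<in> V \<Longrightarrow> v \<in> nbrs V c b u \<Longrightarrow> u \<in> nbrs V c b v"
  by (auto simp: nbrs_def insert_commute)

lemma nbrs_in: "v \<in> nbrs V c b u \<Longrightarrow> v \<in> V"
  by (simp add: nbrs_def)

text \<open>Hall's condition for two sets of leaves. \<open>A\<close> is taken outside
  \<open>W\<close> as far as possible; if it has to enter \<open>W\<close>, it exhausts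
  \<open>U - W\<close>, so what remains of \<open>W\<close> is all of \<open>U \<union> W\<close>
  outside \<open>A\<close>.\<close>

lemma obtain_disjoint_subsets:
  assumes "finite U" "finite W" "m1 \<le> card U" "m2 \<le> card W" "m1 + m2 \<le> card (U \<union> W)"
  obtains A B where "A \<subseteq> U" "B \<subseteq> W" "A \<inter> B = {}" "card A = m1" "card B = m2"
proof -
  have "\<exists>A \<subseteq> U. card A = m1 \<and> m2 \<le> card (W - A)"
  proof (cases "m1 \<le> card (U - W)")
    case True
    then obtain A where "A \<subseteq> U - W" "card A = m1"
      using obtain_subset_with_card_n by metis
    moreover from this have "W - A = W" by blast
    ultimately show ?thesis using assms by auto
  next
    case False
    then obtain A where A: "U - W \<subseteq> A" "A \<subseteq> U" "card A = m1"
      using exists_subset_between[of "U - W" m1 U] assms by auto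
    have "W - A = (U \<union> W) - A" using A by blast
    also have "card \<dots> = card (U \<union> W) - card A"
      using A assms by (intro card_Diff_subset) (auto dest: finite_subset)
    finally have "card (W - A) = card (U \<union> W) - m1" using A by simp
    then show ?thesis using A assms by auto
  qed
  then obtain A where A: "A \<subseteq> U" "card A = m1" "m2 \<le> card (W - A)" by blast
  then obtain B where B: "B \<subseteq> W - A" "card B = m2"
    using obtain_subset_with_card_n by metis
  show ?thesis
  proof (rule that)
    show "B \<subseteq> W" "A \<inter> B = {}" using B(1) by blast+
  qed (use A B in auto)
qed

text \<open>Each centre lies in the other's neighbourhood and cannot serve as a leaf. Removing it
  costs one in each degree and two in the union, which leaves exactly what
  \<open>obtain_disjoint_subsets\<close> requires.\<close>

lemma contains_copy_double_star:
  fixes n m1 m2 :: nat and c :: "nat set \<Rightarrow> bool"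
  defines "V \<equiv> {..<n}"
  assumes u: "u \<in> V" and v: "v \<in> nbrs V c b u"
    and deg: "m1 < card (nbrs V c b u)" "m2 < card (nbrs V c b v)"
    and un: "m1 + m2 + 2 \<le> card (nbrs V c b u \<union> nbrs V c b v)"
  shows "contains_copy (colour_class n c b) (double_star m1 m2)"
proof -
  let ?U = "nbrs V c b u - {v}" and ?W = "nbrs V c b v - {u}"
  have fin: "finite V" by (simp add: V_def)
  have vV: "v \<in> V" and uv: "u \<noteq> v" and cuv: "c {u, v} = b" and u': "u \<in> nbrs V c b v"
    using u v nbrs_sym[OF u v] by (auto simp: nbrs_def)
  have "?U \<union> ?W = (nbrs V c b u \<union> nbrs V c b v) - {u, v}"
    by (auto simp: nbrs_def)
  then have "card (?U \<union> ?W) = card (nbrs V c b u \<union> nbrs V c b v) - card {u, v}"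
    using v u' fin by (simp add: card_Diff_subset)
  then have "m1 + m2 \<le> card (?U \<union> ?W)"
    using un uv by simp
  moreover have "m1 \<le> card ?U" "m2 \<le> card ?W"
    using deg v u' fin by simp_all
  ultimately obtain A B where AB: "A \<subseteq> ?U" "B \<subseteq> ?W" "A \<inter> B = {}" "card A = m1" "card B = m2"
    using obtain_disjoint_subsets[of ?U ?W m1 m2] fin by auto
  have "finite A" "finite B"
    using AB fin by (meson finite_Diff finite_nbrs finite_subset)+
  then obtain g h where g: "bij_betw g {1..m1} A" and h: "bij_betw h {1..m2} B"
    using AB by (metis card_atLeastAtMost diff_Suc_1 finite_atLeastAtMost finite_same_card_bij)
  define f where "f = case_sum (\<lambda>i. if i = 0 then u else g i) (\<lambda>i. if i = 0 then v else h i)"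
  have gA: "g i \<in> A" if "0 < i" "i \<le> m1" for i
    using bij_betwE[OF g] that by simp
  have hB: "h i \<in> B" if "0 < i" "i \<le> m2" for i
    using bij_betwE[OF h] that by simp
  have gi: "i = j" if "g i = g j" "0 < i" "i \<le> m1" "0 < j" "j \<le> m1" for i j
    using inj_onD[OF bij_betw_imp_inj_on[OF g] that(1)] that(2-5) by simp
  have hi: "i = j" if "h i = h j" "0 < i" "i \<le> m2" "0 < j" "j \<le> m2" for i j
    using inj_onD[OF bij_betw_imp_inj_on[OF h] that(1)] that(2-5) by simp
  have A: "x \<in> V" "x \<noteq> u" "x \<noteq> v" "c {u, x} = b" if "x \<in> A" for x
    using AB(1) that by (auto simp: nbrs_def)
  have B: "x \<in> V" "x \<noteq> u" "x \<noteq> v" "c {v, x} = b" if "x \<in> B" for x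
    using AB(2) that by (auto simp: nbrs_def)
  have vert: "fst (double_star m1 m2) = Inl ` {0..m1} \<union> Inr ` {0..m2}"
    by (simp add: double_star_def star_def)
  have fl: "i = j" if "f (Inl i) = f (Inl j)" "i \<le> m1" "j \<le> m1" for i j
    using that A(2)[OF gA[of i]] A(2)[OF gA[of j]] gi[of i j]
    by (cases "i = 0"; cases "j = 0") (auto simp: f_def)
  have fr: "i = j" if "f (Inr i) = f (Inr j)" "i \<le> m2" "j \<le> m2" for i j
    using that B(3)[OF hB[of i]] B(3)[OF hB[of j]] hi[of i j]
    by (cases "i = 0"; cases "j = 0") (auto simp: f_def)
  have flr: "f (Inl i) \<noteq> f (Inr j)" if "i \<le> m1" "j \<le> m2" for i j
    using that uv A(3)[OF gA[of i]] B(2)[OF hB[of j]] gA[of i] hB[of j] AB(3)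
    by (cases "i = 0"; cases "j = 0") (auto simp: f_def)
  have "inj_on f (fst (double_star m1 m2))"
  proof (rule inj_onI)
    fix x y
    assume x: "x \<in> fst (double_star m1 m2)" and y: "y \<in> fst (double_star m1 m2)"
      and eq: "f x = f y"
    consider (ll) i j where "x = Inl i" "y = Inl j" "i \<le> m1" "j \<le> m1"
      | (rr) i j where "x = Inr i" "y = Inr j" "i \<le> m2" "j \<le> m2"
      | (lr) i j where "x = Inl i" "y = Inr j" "i \<le> m1" "j \<le> m2"
      | (rl) i j where "x = Inr i" "y = Inl j" "i \<le> m2" "j \<le> m1"
      using x y unfolding vert by auto
    then show "x = y"
    proof cases
      case ll
      then show ?thesis using fl[of i j] eq by simp
    next
      case rr
      then show ?thesis using fr[of i j] eq by simp
    next
      case lr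
      then show ?thesis using flr[of i j] eq by simp
    next
      case rl
      then show ?thesis using flr[of j i] eq by simp
    qed
  qed
  moreover have "f ` fst (double_star m1 m2) \<subseteq> V"
    using u vV A(1)[OF gA] B(1)[OF hB] unfolding vert f_def by auto
  moreover have "f ` e \<in> snd (colour_class n c b)" if e: "e \<in> snd (double_star m1 m2)" for e
  proof -
    have edge: "{x, y} \<in> snd (colour_class n c b)"
      if "x \<in> V" "y \<in> V" "x \<noteq> y" "c {x, y} = b" for x y
      using that by (auto simp: colour_class_def V_def nsets_def)
    consider i where "e = {Inl 0, Inl i}" "0 < i" "i \<le> m1"
      | i where "e = {Inr 0, Inr i}" "0 < i" "i \<le> m2" | "e = {Inl 0, Inr 0}"
      using e by (auto simp: double_star_def star_def)
    then show ?thesis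
    proof cases
      case 1
      then have "f ` e = {u, g i}" by (simp add: f_def)
      then show ?thesis using edge[of u "g i"] A[OF gA[of i]] 1 u by auto
    next
      case 2
      then have "f ` e = {v, h i}" by (simp add: f_def)
      then show ?thesis using edge[of v "h i"] B[OF hB[of i]] 2 vV by auto
    next
      case 3
      then have "f ` e = {u, v}" by (simp add: f_def)
      then show ?thesis using edge[of u v] u vV uv cuv by auto
    qed
  qed
  ultimately show ?thesis
    unfolding contains_copy_def by (intro exI[of _ f]) (auto simp: colour_class_def V_def)
qed

section \<open>Counting triangles with an odd edge\<close>

text \<open>For each unordered pair of points of \<open>A\<close> joined to \<open>b\<close> in different colours, only one of its
  two orderings is counted, namely the one fixed by the colour of the pair itself.\<close>

lemma card_odd_triangles:
  fixes c :: "'a set \<Rightarrow> bool"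
  assumes "finite A"
  shows "4 * card {(a, x) \<in> A \<times> A. c {x, a} = c {x, b} \<and> c {x, b} \<noteq> c {a, b}} \<le> (card A)\<^sup>2"
    (is "4 * card ?T \<le> _")
proof -
  let ?Y = "{a \<in> A. c {a, b}}" and ?Z = "{a \<in> A. \<not> c {a, b}}"
  define F where "F = (\<lambda>(a, x). if c {a, b} then (a, x) else (x, a))"
  have "inj_on F ?T"
    by (auto simp: inj_on_def F_def insert_commute split: if_splits)
  moreover have "F ` ?T \<subseteq> ?Y \<times> ?Z"
    by (auto simp: F_def)
  moreover have "finite (?Y \<times> ?Z)" using assms by simp
  ultimately have T: "card ?T \<le> card ?Y * card ?Z"
    using card_inj_on_le[of F ?T "?Y \<times> ?Z"] by (simp add: card_cartesian_product)
  have "A = ?Y \<union> ?Z" by blast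
  then have A: "card A = card ?Y + card ?Z"
    using assms by (metis (no_types, lifting) card_Un_disjoint disjoint_iff finite_Un mem_Collect_eq)
  have "4 * (int (card ?Y) * int (card ?Z)) \<le> (int (card ?Y) + int (card ?Z))\<^sup>2"
    using zero_le_power2[of "int (card ?Y) - int (card ?Z)"]
    by (simp add: power2_eq_square algebra_simps)
  then have "4 * (card ?Y * card ?Z) \<le> (card A)\<^sup>2"
    unfolding A by (metis (no_types, lifting) of_nat_add of_nat_le_iff of_nat_mult of_nat_numeral of_nat_power)
  then show ?thesis using T by linarith
qed

section \<open>Degrees and common neighbours without a monochromatic double star\<close>

text \<open>\<open>union_le\<close> is \<open>contains_copy_double_star\<close> read backwards. In
  the theorem, \<open>card_V1\<close> comes from \<open>m1 < 3 * m2\<close> and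
  \<open>card_V2\<close> from the golden ratio hypothesis.\<close>

locale double_star_free_colouring =
  fixes V :: "'a set" and c :: "'a set \<Rightarrow> bool" and m1 m2 :: nat
  assumes fin: "finite V" and m1_pos: "0 < m1"
    and card_V1: "2 * m1 + 2 \<le> card V" and card_V2: "m1 + 2 * m2 + 2 \<le> card V"
    and union_le: "\<lbrakk>u \<in> V; v \<in> nbrs V c b u; m1 < card (nbrs V c b u); m2 < card (nbrs V c b v)\<rbrakk>
      \<Longrightarrow> card (nbrs V c b u \<union> nbrs V c b v) \<le> m1 + m2 + 1"
begin

abbreviation N where "N \<equiv> nbrs V c"

lemma card_nbrs_sum:
  assumes "v \<in> V"
  shows "Suc (card (N b v) + card (N (\<not> b) v)) = card V"
proof -
  have "V = insert v (N b v \<union> N (\<not> b) v)" "v \<notin> N b v \<union> N (\<not> b) v" "N b v \<inter> N (\<not> b) v = {}"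
    using assms by (auto simp: nbrs_def)
  then show ?thesis
    using fin by (metis card_Un_disjoint card_insert_disjoint finite_Un finite_insert)
qed

text \<open>The bound drops from \<open>m1 + m2 + 1\<close> to \<open>m1 + m2\<close> because
  \<open>u\<close> itself lies in the union but in neither of the two sets counted.\<close>

lemma card_nbrs_diff:
  assumes "u \<in> V" "v \<in> N b u" "card (N b u \<union> N b v) \<le> m1 + m2 + 1"
  shows "card (N b v \<inter> N (\<not> b) u) + card (N b u) \<le> m1 + m2"
proof -
  have "insert u (N b v \<inter> N (\<not> b) u) \<union> N b u \<subseteq> N b u \<union> N b v"
    using nbrs_sym[OF assms(1,2)] by auto
  then have "card (insert u (N b v \<inter> N (\<not> b) u) \<union> N b u) \<le> m1 + m2 + 1"
    using assms(3) fin by (meson card_mono finite_Un finite_nbrs le_trans)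
  moreover have "insert u (N b v \<inter> N (\<not> b) u) \<inter> N b u = {}" "u \<notin> N b v \<inter> N (\<not> b) u"
    by (auto simp: nbrs_def)
  ultimately show ?thesis
    using fin by (simp add: card_Un_disjoint del: Un_insert_left)
qed

text \<open>The degree of \<open>v\<close> in the other colour exceeds \<open>m1 + m2\<close>, more
  than \<open>card_nbrs_diff\<close> allows if \<open>w\<close> is a second centre.\<close>

lemma small_nbrs_opposite:
  assumes v: "v \<in> V" "card (N b v) \<le> m2" and w: "w \<in> N (\<not> b) v"
  shows "card (N (\<not> b) w) \<le> m2"
proof (rule ccontr)
  assume "\<not> ?thesis"
  moreover have "m1 + m2 < card (N (\<not> b) v)"
    using card_nbrs_sum[OF v(1), of b] v(2) card_V2 by linarith
  ultimately show False
    using union_le[OF v(1) w] card_nbrs_diff[OF v(1) w] by simp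
qed

text \<open>A small degree passes along edges of the opposite colour, which then becomes the small
  one. Going from \<open>v\<close> to \<open>x\<close> both directly and through \<open>w\<close>
  makes both degrees of \<open>x\<close> small, and these are too few vertices.\<close>

lemma card_nbrs_gt:
  assumes v: "v \<in> V"
  shows "m2 < card (N b v)"
proof (rule ccontr)
  assume "\<not> ?thesis"
  then have small: "card (N b v) \<le> m2" by simp
  let ?W = "N (\<not> b) v"
  have W: "m1 + m2 < card ?W"
    using card_nbrs_sum[OF v, of b] small card_V2 by linarith
  then obtain w where w: "w \<in> ?W" by fastforce
  have wV: "w \<in> V" and w_small: "card (N (\<not> b) w) \<le> m2"
    using nbrs_in[OF w] small_nbrs_opposite[OF v small w] by auto
  have "card (insert w (N (\<not> b) w)) \<le> m2 + 1"
    using w_small fin by (metis Suc_eq_plus1 add_le_cancel_right card_insert_le_m1 card_insert_if finite_nbrs le_SucI)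
  then have "\<not> ?W \<subseteq> insert w (N (\<not> b) w)"
    using W m1_pos fin card_mono[of "insert w (N (\<not> b) w)" ?W] by force
  then obtain x where x: "x \<in> ?W" "x \<noteq> w" "x \<notin> N (\<not> b) w" by blast
  then have "x \<in> N b w" by (auto simp: nbrs_def)
  then have "card (N b x) \<le> m2"
    using small_nbrs_opposite[of w "\<not> b" x] wV w_small by simp
  moreover have "card (N (\<not> b) x) \<le> m2"
    using small_nbrs_opposite[OF v small x(1)] .
  ultimately show False
    using card_nbrs_sum[OF nbrs_in[OF x(1)], of b] card_V2 by linarith
qed

lemma card_union_le:
  assumes "u \<in> V" "v \<in> N b u" "m1 < card (N b u)"
  shows "card (N b u \<union> N b v) \<le> m1 + m2 + 1"
  using union_le assms card_nbrs_gt nbrs_in by metis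

text \<open>Both ends of the edge lie in the union of the neighbourhoods, so every vertex outside it
  is joined to both ends in the other colour.\<close>

lemma card_common_nbrs:
  assumes "u \<in> V" "v \<in> N b u" "m1 < card (N b u)"
  shows "card V \<le> card (N (\<not> b) u \<inter> N (\<not> b) v) + (m1 + m2 + 1)"
proof -
  have "V \<subseteq> (N (\<not> b) u \<inter> N (\<not> b) v) \<union> (N b u \<union> N b v)"
    using assms(1,2) by (auto simp: nbrs_def insert_commute)
  then have "card V \<le> card ((N (\<not> b) u \<inter> N (\<not> b) v) \<union> (N b u \<union> N b v))"
    using fin by (intro card_mono) auto
  also have "\<dots> \<le> card (N (\<not> b) u \<inter> N (\<not> b) v) + card (N b u \<union> N b v)"
    by (rule card_Un_le)
  finally show ?thesis
    using card_union_le[OF assms] by linarith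
qed

section \<open>All vertices have small degree in the same colour\<close>

text \<open>Each pair in \<open>A \<times> B\<close> lies in many triangles in which it has the odd colour, and such a
  triangle contains two pairs of \<open>A \<times> B\<close> of different colours.\<close>

lemma partition_trivial:
  assumes V: "V = A \<union> B" and disj: "A \<inter> B = {}"
    and A: "\<And>a. a \<in> A \<Longrightarrow> m1 < card (N True a)"
    and B: "\<And>b. b \<in> B \<Longrightarrow> m1 < card (N False b)"
  shows "A = {} \<or> B = {}"
proof (rule ccontr)
  assume ne: "\<not> ?thesis"
  have finA: "finite A" and finB: "finite B" using fin V by auto
  then have pos: "0 < card A * card B" using ne by (simp add: card_gt_0_iff)
  define k where "k = card V - (m1 + m2 + 1)"
  \<comment> \<open>Third vertices of triangles in which \<open>ab\<close> is the odd edge, split by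
    side. \<open>Q\<close> exchanges \<open>a\<close> and \<open>b\<close> so that
    \<open>card_odd_triangles\<close> applies to \<open>B\<close>.\<close>
  define P where "P a b = {x \<in> A. c {x, a} = c {x, b} \<and> c {x, b} \<noteq> c {a, b}}" for a b
  define Q where "Q a b = {x \<in> B. c {x, b} = c {x, a} \<and> c {x, a} \<noteq> c {b, a}}" for a b
  have PQ: "k \<le> card (P a b) + card (Q a b)" if ab: "a \<in> A" "b \<in> B" for a b
  proof -
    let ?r = "c {a, b}"
    have ne: "a \<noteq> b" and aV: "a \<in> V" and bV: "b \<in> V" using ab disj V by auto
    \<comment> \<open>The end whose degree is known to be large in the colour of the edge is
      \<open>a\<close> for \<open>True\<close> and \<open>b\<close> for
      \<open>False\<close>.\<close>
    have "card V \<le> card (N (\<not> ?r) a \<inter> N (\<not> ?r) b) + (m1 + m2 + 1)"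
    proof (cases ?r)
      case True
      then show ?thesis
        using card_common_nbrs[of a b True] A[OF ab(1)] ne aV bV by (simp add: nbrs_def)
    next
      case False
      then show ?thesis
        using card_common_nbrs[of b a False] B[OF ab(2)] ne aV bV
        by (simp add: nbrs_def insert_commute Int_commute)
    qed
    moreover have "N (\<not> ?r) a \<inter> N (\<not> ?r) b \<subseteq> P a b \<union> Q a b"
      using V by (auto simp: nbrs_def P_def Q_def insert_commute)
    moreover have "finite (P a b \<union> Q a b)"
      using finA finB by (simp add: P_def Q_def)
    ultimately show ?thesis
      unfolding k_def using card_mono[of "P a b \<union> Q a b"] card_Un_le[of "P a b" "Q a b"]
      by (smt (verit, best) le_diff_conv le_trans add_le_mono1)
  qed
  have P: "4 * (\<Sum>a\<in>A. card (P a b)) \<le> (card A)\<^sup>2" for b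
  proof -
    have "(\<Sum>a\<in>A. card (P a b)) = card (SIGMA a:A. P a b)"
      using finA by (simp add: card_SigmaI P_def)
    also have "(SIGMA a:A. P a b)
        = {(a, x) \<in> A \<times> A. c {x, a} = c {x, b} \<and> c {x, b} \<noteq> c {a, b}}"
      by (auto simp: P_def)
    finally show ?thesis using card_odd_triangles[OF finA, of c b] by simp
  qed
  have Q: "4 * (\<Sum>b\<in>B. card (Q a b)) \<le> (card B)\<^sup>2" for a
  proof -
    have "(\<Sum>b\<in>B. card (Q a b)) = card (SIGMA b:B. Q a b)"
      using finB by (simp add: card_SigmaI Q_def)
    also have "(SIGMA b:B. Q a b)
        = {(b, x) \<in> B \<times> B. c {x, b} = c {x, a} \<and> c {x, a} \<noteq> c {b, a}}"
      by (auto simp: Q_def)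
    finally show ?thesis using card_odd_triangles[OF finB, of c a] by simp
  qed
  have "card A * card B * k = (\<Sum>a\<in>A. \<Sum>b\<in>B. k)" by simp
  also have "\<dots> \<le> (\<Sum>a\<in>A. \<Sum>b\<in>B. card (P a b) + card (Q a b))"
    using PQ by (intro sum_mono) auto
  also have "\<dots> = (\<Sum>b\<in>B. \<Sum>a\<in>A. card (P a b)) + (\<Sum>a\<in>A. \<Sum>b\<in>B. card (Q a b))"
    by (simp add: sum.distrib sum.swap[of _ A])
  finally have "4 * (card A * card B * k)
      \<le> (\<Sum>b\<in>B. 4 * (\<Sum>a\<in>A. card (P a b))) + (\<Sum>a\<in>A. 4 * (\<Sum>b\<in>B. card (Q a b)))"
    by (simp add: sum_distrib_left[symmetric])
  also have "\<dots> \<le> (\<Sum>b\<in>B. (card A)\<^sup>2) + (\<Sum>a\<in>A. (card B)\<^sup>2)"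
    using P Q by (intro add_mono sum_mono) auto
  also have "\<dots> = card A * card B * (card A + card B)"
    by (simp add: power2_eq_square algebra_simps)
  also have "card A + card B = card V"
    using V disj finA finB by (simp add: card_Un_disjoint)
  finally have "card A * card B * (4 * k) \<le> card A * card B * card V"
    by (simp add: mult.left_commute)
  then have "4 * k \<le> card V" using pos by (metis nat_mult_le_cancel1)
  \<comment> \<open>\<open>card_V1\<close> plus twice \<open>card_V2\<close> gives
    \<open>4 * m1 + 4 * m2 + 6 \<le> 3 * card V\<close>, whereas \<open>4 * k \<le> card V\<close>
    means \<open>3 * card V \<le> 4 * m1 + 4 * m2 + 4\<close>.\<close>
  then show False unfolding k_def using card_V1 card_V2 by linarith
qed

lemma major_colour:
  obtains b where "\<And>v. v \<in> V \<Longrightarrow> card (N (\<not> b) v) \<le> m1"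
proof -
  let ?A = "{v \<in> V. m1 < card (N True v)}" and ?B = "{v \<in> V. m1 < card (N False v)}"
  have cover: "v \<in> ?A \<or> v \<in> ?B" if "v \<in> V" for v
    using card_nbrs_sum[OF that, of True] card_V1 that by auto
  have AB: "?A = {} \<or> V - ?A = {}" using cover by (intro partition_trivial) auto
  have BA: "V - ?B = {} \<or> ?B = {}" using cover by (intro partition_trivial) auto
  have "?A = {} \<or> ?B = {}"
  proof (rule ccontr)
    assume "\<not> ?thesis"
    then have all: "?A = V" "?B = V" using AB BA by blast+
    obtain x where x: "x \<in> V" using card_V1 by fastforce
    \<comment> \<open>With both degrees large everywhere, any split of \<open>V\<close> meets the
      hypotheses, in particular one with two nonempty parts.\<close>
    have "V - {x} = {} \<or> {x} = {}"
      using all x by (intro partition_trivial) auto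
    then have "V = {x}" using x by blast
    then have "card V = 1" by simp
    then show False using card_V1 by simp
  qed
  then show ?thesis using that[of True] that[of False] by fastforce
qed

section \<open>Double counting around one vertex\<close>

lemma no_large_colouring:
  assumes big: "int m1 * (3 * int m1 + int m2) \<le> (int (card V) - 1) * (int (card V) - 1 - int m2)"
  shows False
proof -
  obtain b where minor: "\<And>v. v \<in> V \<Longrightarrow> card (N (\<not> b) v) \<le> m1"
    using major_colour by blast
  have major: "card V \<le> card (N b v) + (m1 + 1)" "m1 < card (N b v)" if "v \<in> V" for v
    using card_nbrs_sum[OF that, of b] minor[OF that] card_V1 by linarith+
  obtain u where u: "u \<in> V" using card_V1 by fastforce
  let ?R = "N b u" and ?C = "N (\<not> b) u"
  \<comment> \<open>\<open>m1 + m2\<close> from \<open>card_nbrs_diff\<close> minus the least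
    possible degree \<open>card V - (m1 + 1)\<close> in colour \<open>b\<close>.\<close>
  define t where "t = 2 * m1 + m2 + 1 - card V"
  have lower: "card V - (m1 + m2 + 1) \<le> card {w \<in> ?C. w \<in> N (\<not> b) v}" if "v \<in> ?R" for v
  proof -
    have "?C \<inter> N (\<not> b) v = {w \<in> ?C. w \<in> N (\<not> b) v}" by blast
    then show ?thesis using card_common_nbrs[OF u that major(2)[OF u]] by simp
  qed
  have near: "card (N b x \<inter> N (\<not> b) y) \<le> t" if "y \<in> V" "x \<in> N b y" for x y
    using card_nbrs_diff[OF that card_union_le[OF that major(2)[OF that(1)]]] major(1)[OF that(1)]
    unfolding t_def by linarith
  have upper: "card {v \<in> ?R. w \<in> N (\<not> b) v} + 1 \<le> 2 * t" if w: "w \<in> ?C" for w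
  proof -
    have wV: "w \<in> V" and uw: "u \<noteq> w" using w by (auto simp: nbrs_def)
    have "\<exists>v. v \<in> ?R \<inter> N b w"
    proof (rule ccontr)
      assume "\<not> ?thesis"
      then have "card (?R \<union> N b w) = card ?R + card (N b w)"
        using fin by (intro card_Un_disjoint) auto
      \<comment> \<open>The edge \<open>uw\<close> does not have colour \<open>b\<close>, so neither
        end is in either set. Two disjoint sets of size at least \<open>card V - (m1 + 1)\<close> do
        not fit.\<close>
      moreover have "?R \<union> N b w \<subseteq> V - {u, w}"
        using w by (auto simp: nbrs_def insert_commute)
      then have "card (?R \<union> N b w) \<le> card V - 2"
        using fin u wV uw card_mono[of "V - {u, w}" "?R \<union> N b w"] by (simp add: card_Diff_subset)
      ultimately show False
        using major(1)[OF u] major(1)[OF wV] card_V1 by linarith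
    qed
    then obtain v where v: "v \<in> ?R" "v \<in> N b w" by blast
    have vV: "v \<in> V" and vu: "u \<in> N b v"
      using nbrs_in[OF v(1)] nbrs_sym[OF u v(1)] by auto
    let ?S = "{x \<in> ?R. w \<in> N (\<not> b) x}"
    let ?S1 = "N b u \<inter> N (\<not> b) v" and ?S2 = "N b v \<inter> N (\<not> b) w"
    \<comment> \<open>A vertex of \<open>?S\<close> is split off from \<open>v\<close> (in
      \<open>?S1\<close>) or from \<open>w\<close> (in \<open>?S2\<close>). Leaving out
      \<open>u\<close>, which is in \<open>?S2\<close> but not in \<open>?S\<close>, saves one; this
      yields the term \<open>- int m1\<close> that finally contradicts the non-strict
      \<open>big\<close>.\<close>
    have "?S \<subseteq> ?S1 \<union> (?S2 - {u})"
      using v vV by (auto simp: nbrs_def insert_commute)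
    then have "card ?S \<le> card (?S1 \<union> (?S2 - {u}))"
      using fin by (intro card_mono) auto
    also have "\<dots> \<le> card ?S1 + card (?S2 - {u})" by (rule card_Un_le)
    finally have "card ?S \<le> card ?S1 + card (?S2 - {u})" .
    moreover have "u \<in> ?S2" using vu nbrs_sym[OF u w] by simp
    then have "card (?S2 - {u}) + 1 = card ?S2"
      using fin card_Suc_Diff1[of ?S2 u] by simp
    ultimately show ?thesis
      using near[OF vV vu] near[OF wV v(2)] by linarith
  qed
  have "card ?R * (card V - (m1 + m2 + 1)) \<le> (\<Sum>v\<in>?R. card {w \<in> ?C. w \<in> N (\<not> b) v})"
    using sum_mono[OF lower, of ?R] by simp
  also have "\<dots> = (\<Sum>w\<in>?C. card {v \<in> ?R. w \<in> N (\<not> b) v})"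
    using fin by (intro sum_multicount_gen) auto
  also have "\<dots> \<le> (\<Sum>w\<in>?C. 2 * t - 1)"
    using upper by (intro sum_mono add_le_imp_le_diff) auto
  also have "\<dots> = card ?C * (2 * t - 1)" by simp
  also have "\<dots> \<le> m1 * (2 * t - 1)" using minor[OF u] by simp
  finally have le: "card ?R * (card V - (m1 + m2 + 1)) \<le> m1 * (2 * t - 1)" .
  have "card V - (m1 + 1) \<le> card ?R" using major(1)[OF u] by simp
  then have main: "(card V - (m1 + 1)) * (card V - (m1 + m2 + 1)) \<le> m1 * (2 * t - 1)"
    using le mult_le_mono1 le_trans by blast
  \<comment> \<open>A positive left side forces \<open>t\<close> to be positive, so neither
    \<open>t\<close> nor \<open>2 * t - 1\<close> is truncated on passing to integers.\<close>
  have pos: "0 < (card V - (m1 + 1)) * (card V - (m1 + m2 + 1))"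
    using card_V1 card_V2 m1_pos by simp
  then have tpos: "0 < t" using main by (cases t) auto
  define n where "n = int (card V) - 1"
  have "(n - int m1) * (n - int m1 - int m2)
      = int ((card V - (m1 + 1)) * (card V - (m1 + m2 + 1)))"
    using card_V1 card_V2 unfolding n_def of_nat_mult by (intro arg_cong2[where f = "(*)"]) auto
  also have "\<dots> \<le> int (m1 * (2 * t - 1))" using main by (simp only: of_nat_le_iff)
  also have "\<dots> = int m1 * (2 * (2 * int m1 + int m2 - n) - 1)"
    using tpos by (simp add: n_def t_def of_nat_diff)
  finally have "n * (n - int m2) \<le> int m1 * (3 * int m1 + int m2) - int m1"
    by (simp add: algebra_simps)
  then show False using big m1_pos by (simp add: n_def)
qed

end

section \<open>From the square root bound to the integer inequalities\<close>

theorem theorem2: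
  fixes m1 m2 :: nat
  assumes "m1 > 0" and "m2 > 0"
    and "(sqrt 5 + 1) / 2 * real m2 < real m1" and "m1 < 3 * m2"
  shows "int (ramsey_number (double_star m1 m2))
    \<le> \<lceil>sqrt (2 * (real m1)\<^sup>2 + (real m1 + real m2 / 2)\<^sup>2) + real m2 / 2\<rceil> + 1"
proof -
  define X where "X = sqrt (2 * (real m1)\<^sup>2 + (real m1 + real m2 / 2)\<^sup>2)"
  define n where "n = nat (\<lceil>X + real m2 / 2\<rceil> + 1)"
  have X0: "0 \<le> X" by (simp add: X_def)
  have X2: "X\<^sup>2 = 2 * (real m1)\<^sup>2 + (real m1 + real m2 / 2)\<^sup>2" by (simp add: X_def)
  have "0 \<le> \<lceil>X + real m2 / 2\<rceil>" using X0 by simp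
  then have n: "int n = \<lceil>X + real m2 / 2\<rceil> + 1" by (simp add: n_def)
  have nX: "X + real m2 / 2 \<le> real n - 1"
  proof -
    have "real n = real_of_int \<lceil>X + real m2 / 2\<rceil> + 1"
      using n by (metis of_int_1 of_int_add of_int_of_nat_eq)
    then show ?thesis using le_of_int_ceiling[of "X + real m2 / 2"] by linarith
  qed
  \<comment> \<open>After expansion this is \<open>m1 * m1 < 3 * m1 * m2\<close>.\<close>
  have "(2 * real m1 - real m2 / 2)\<^sup>2 < X\<^sup>2"
  proof -
    have "real m1 * real m1 < real m1 * (3 * real m2)"
      using assms by (intro mult_strict_left_mono) auto
    then show ?thesis unfolding X2 by (simp add: power2_eq_square algebra_simps)
  qed
  then have 1: "2 * real m1 < X + real m2 / 2"
    using X0 power_less_imp_less_base by fastforce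
  \<comment> \<open>After expansion this is \<open>m2 * m2 + m1 * m2 < m1 * m1\<close>, the golden
    ratio hypothesis; completing the square turns it into the comparison with
    \<open>sqrt 5 * real m2\<close>.\<close>
  have "(real m1 + 3 / 2 * real m2)\<^sup>2 < X\<^sup>2"
  proof -
    have "sqrt 5 * real m2 < 2 * real m1 - real m2" using assms(3) by (simp add: field_simps)
    then have "(sqrt 5 * real m2)\<^sup>2 < (2 * real m1 - real m2)\<^sup>2"
      by (intro power_strict_mono) auto
    then show ?thesis
      unfolding X2 by (simp add: power_mult_distrib power2_eq_square algebra_simps)
  qed
  then have 2: "real m1 + 2 * real m2 < X + real m2 / 2"
    using X0 power_less_imp_less_base by fastforce
  \<comment> \<open>Strictness in \<open>1\<close> and \<open>2\<close> gains one unit by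
    integrality, and the \<open>+ 1\<close> in \<open>n\<close> gives the other.\<close>
  have n1: "2 * m1 + 2 \<le> n" and n2: "m1 + 2 * m2 + 2 \<le> n"
    using 1 2 nX by linarith+
  \<comment> \<open>Adding \<open>m2 * m2 / 4\<close> to both sides of \<open>quad\<close> completes
    the squares and gives this inequality.\<close>
  have "X\<^sup>2 \<le> (real n - 1 - real m2 / 2)\<^sup>2"
    using nX X0 by (intro power_mono) auto
  then have "real m1 * (3 * real m1 + real m2) \<le> (real n - 1) * (real n - 1 - real m2)"
    unfolding X2 by (simp add: power2_eq_square algebra_simps)
  then have "real_of_int (int m1 * (3 * int m1 + int m2))
      \<le> real_of_int ((int n - 1) * (int n - 1 - int m2))"
    by simp
  then have quad: "int m1 * (3 * int m1 + int m2) \<le> (int n - 1) * (int n - 1 - int m2)"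
    by (simp only: of_int_le_iff)
  have "arrows n (double_star m1 m2)"
    unfolding arrows_def
  proof (rule allI, rule ccontr)
    fix c
    assume none: "\<not> (\<exists>b. contains_copy (colour_class n c b) (double_star m1 m2))"
    interpret double_star_free_colouring "{..<n}" c m1 m2
    proof
      fix u v b
      assume "u \<in> {..<n}" "v \<in> nbrs {..<n} c b u"
        "m1 < card (nbrs {..<n} c b u)" "m2 < card (nbrs {..<n} c b v)"
      then show "card (nbrs {..<n} c b u \<union> nbrs {..<n} c b v) \<le> m1 + m2 + 1"
        using none contains_copy_double_star[of u n v c b m1 m2] by force
    qed (use assms n1 n2 in auto)
    show False using no_large_colouring quad by simp
  qed
  then have "ramsey_number (double_star m1 m2) \<le> n"
    unfolding ramsey_number_def by (rule Least_le)
  then show ?thesis using n unfolding X_def by linarith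
qed

end
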